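(* Let $G$ be a connected graph on $n$ vertices. (1) $c_k\le h_k$ for every $k\in\{1,\dots,n\}$. (2) Let $k\in\{1,\dots,n\}$ and let $\vec\phi_k$ be an eigenvector of the $1$-Laplacian of $G$ with eigenvalue $c_k$. If $S(\vec\phi_k)\ge m$ (with $m\ge1$ an integer), then $h_m\le c_k$.
   Context: $G=(V,E)$ is a finite simple undirected connected graph, $V=\{1,\dots,n\}$, $n\ge 2$; $d_i$ is the degree of $i$; $\mathrm{vol}(A)=\sum_{i\in A}d_i$; $|\partial A|$ is the number of edges between $A$ and $V\setminus A$. $\mathrm{Sgn}(t)=\{1\}$ if $t>0$, $\{-1\}$ if $t<0$, $[-1,1]$ if $t=0$. $I(\vec x)=\sum_{\{i,j\}\in E}|x_i-x_j|$ and $X=\{\vec x\in\mathbb R^n:\sum_i d_i|x_i|=1\}$. A nonzero $\vec x\in\mathbb R^n$ is an eigenvector of the $1$-Laplacian with eigenvalue $\mu$ if there exist $z_{ij}\in\mathrm{Sgn}(x_i-x_j)$ with $z_{ji}=-z_{ij}$ (for all adjacent $i,j$) such that $\sum_{j\sim i}z_{ij}\in\mu d_i\,\mathrm{Sgn}(x_i)$ for all $i\in V$. $c_k=\inf_{\gamma(A)\ge k}\max_{\vec x\in A}I(\vec x)$, the infimum over closed sets $A=-A\subset X$, where $\gamma(A)$ is the Krasnoselskii genus: the least integer $m\ge0$ for which there is an odd continuous map $A\to\mathbb R^m\setminus\{0\}$. Each $c_k$ is an eigenvalue (known). The $k$-way Cheeger constant is $h_k=\min_{S_1,\dots,S_k}\max_{1\le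 i\le k}\frac{|\partial S_i|}{\mathrm{vol}(S_i)}$, the minimum over all $k$-tuples of nonempty pairwise disjoint subsets of $V$. The (strong) nodal domains of $\vec x$ are the vertex sets of the connected components of the subgraphs induced on $\{i:x_i>0\}$ and on $\{i:x_i<0\}$; $S(\vec x)$ is the total number of them. *)

theory Defs
  imports "HOL-Analysis.Analysis"
begin

(* A graph on the finite vertex type 'n (so n = CARD('n)) is given by its set of
   edges, each edge being a two-element set of vertices. *)

definition simple_graph :: "'n::finite set set \<Rightarrow> bool" where
  "simple_graph E \<longleftrightarrow> (\<forall>e\<in>E. card e = 2)"

definition induced_comps :: "'n::finite set set \<Rightarrow> 'n set \<Rightarrow> 'n set set" where
  "induced_comps E U =
     U // ({(i, j). i \<in> U \<and> j \<in> U \<and> {i, j} \<in> E}\<^sup>* \<inter> U \<times> U)"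

definition connected_graph :: "'n::finite set set \<Rightarrow> bool" where
  "connected_graph E \<longleftrightarrow> (\<forall>i j. (i, j) \<in> {(i, j). {i, j} \<in> E}\<^sup>*)"

definition deg :: "'n::finite set set \<Rightarrow> 'n \<Rightarrow> nat" where
  "deg E i = card {j. {i, j} \<in> E}"

definition vol :: "'n::finite set set \<Rightarrow> 'n set \<Rightarrow> nat" where
  "vol E A = (\<Sum>i\<in>A. deg E i)"

definition edge_boundary :: "'n::finite set set \<Rightarrow> 'n set \<Rightarrow> 'n set set" where
  "edge_boundary E A = {e \<in> E. \<exists>i\<in>A. \<exists>j\<in>- A. e = {i, j}}"

definition Sgn :: "real \<Rightarrow> real set" where
  "Sgn t = (if t > 0 then {1} else if t < 0 then {-1} else {-1..1})"

(* The quantity |x_i - x_j| does not depend on the orientation of the edge {i, j}, so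
   it is well defined on unordered edges; see edge_diff_pair. *)
definition edge_diff :: "real ^ 'n::finite \<Rightarrow> 'n set \<Rightarrow> real" where
  "edge_diff x e = (THE r. \<exists>i j. e = {i, j} \<and> r = \<bar>x $ i - x $ j\<bar>)"

lemma edge_diff_pair: "edge_diff x {i, j} = \<bar>x $ i - x $ j\<bar>"
  unfolding edge_diff_def
  by (rule the_equality) (auto simp: doubleton_eq_iff)

definition tv :: "'n::finite set set \<Rightarrow> real ^ 'n \<Rightarrow> real" where
  "tv E x = (\<Sum>e\<in>E. edge_diff x e)"

definition wsphere :: "'n::finite set set \<Rightarrow> (real ^ 'n) set" where
  "wsphere E = {x. (\<Sum>i\<in>UNIV. real (deg E i) * \<bar>x $ i\<bar>) = 1}"

definition one_lap_eigenvector :: "'n::finite set set \<Rightarrow> real \<Rightarrow> real ^ 'n \<Rightarrow> bool" where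
  "one_lap_eigenvector E \<mu> x \<longleftrightarrow>
     x \<noteq> 0 \<and>
     (\<exists>z. (\<forall>i j. {i, j} \<in> E \<longrightarrow> z i j \<in> Sgn (x $ i - x $ j) \<and> z j i = - z i j) \<and>
          (\<forall>i. (\<Sum>j | {i, j} \<in> E. z i j) \<in> (\<lambda>s. \<mu> * real (deg E i) * s) ` Sgn (x $ i)))"

(* The origin of Euclidean_space m is the function (\<lambda>_. 0).
   The value is \<infinity> if no suitable m exists. *)
definition genus :: "(real ^ 'n::finite) set \<Rightarrow> enat" where
  "genus A = Inf {enat m | m. \<exists>f.
     continuous_map (top_of_set A) (subtopology (Euclidean_space m) (- {\<lambda>_. 0})) f \<and>
     (\<forall>x\<in>A. - x \<in> A \<longrightarrow> f (- x) = (\<lambda>i. - f x i))}"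

(* The sets A range over closed subsets of the compact set wsphere E (for connected graphs
   with n >= 2), and they are nonempty for k >= 1, so the inner supremum is a maximum.
   For 1 <= k <= n such sets exist (wsphere E itself has genus n by the Borsuk-Ulam
   theorem), so the outer infimum is over a nonempty set of nonnegative reals. *)
definition minmax_c :: "'n::finite set set \<Rightarrow> nat \<Rightarrow> real" where
  "minmax_c E k =
     (INF A \<in> {A. closed A \<and> uminus ` A = A \<and> A \<subseteq> wsphere E \<and> genus A \<ge> enat k}.
        SUP x\<in>A. tv E x)"

(* The set of values is finite because 'n is, and nonempty for 1 <= k <= n. *)
definition cheeger_h :: "'n::finite set set \<Rightarrow> nat \<Rightarrow> real" where
  "cheeger_h E k =
     Min {Max ((\<lambda>i. real (card (edge_boundary E (S i))) / real (vol E (S i))) ` {1..k}) | S.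
        (\<forall>i\<in>{1..k}. S i \<noteq> {}) \<and> disjoint_family_on S {1..k}}"

definition nodal_domains :: "'n::finite set set \<Rightarrow> real ^ 'n \<Rightarrow> 'n set set" where
  "nodal_domains E x = induced_comps E {i. x $ i > 0} \<union> induced_comps E {i. x $ i < 0}"

end

(* Upper bound on c_k: if S_1, ..., S_k attain h_k, then on the span of their indicator vectors
   I(x) <= h_k sum_i d_i |x_i|, and the trace of this span on X has genus at least k by the
   Borsuk-Ulam theorem.  Lower bound: summing the eigenvalue equation over a nodal domain D, the
   terms z_ij of edges inside D cancel and those of boundary edges are all equal to the sign of x
   on D, so |dD| = mu vol(D).

   Borsuk-Ulam, for an odd map f from the n-sphere to R^m - 0 with m <= n, is proved with mod 2
   singular chains.  Since the reduced homology of the sphere vanishes below n, there are chains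
   h_0 = a point, h_1, ..., h_n with boundary h_(i+1) = h_i +- (antipode of h_i); subdividing keeps
   these relations.  Let s_i be the sign of the i-th coordinate of f, completed to an antipodally
   antisymmetric 0-cochain with values in Z/2.  The cup product of the coboundaries of
   s_0, ..., s_(p-1) takes the value 1 on h_p for every p.  But once every simplex of h_m lies in
   one of the open sets {f_i > 0}, {f_i < 0}, one factor of the product vanishes on it. *)

theory Submission
  imports "HOL-Homology.Homology" "HOL-Library.Z2" Defs
begin

subsection \<open>The Borsuk-Ulam theorem\<close>

text \<open>The linear extension of the cochain \<phi> to integral chains. As
  \<open>frag_extend\<close> takes values in a free abelian group, \<phi> is lifted to 0 or 1 in the
  group on the single generator \<open>()\<close>, and the coefficient obtained there is reduced mod
  2.\<close>

definition chain_eval :: "('a \<Rightarrow> bit) \<Rightarrow> ('a \<Rightarrow>\<^sub>0 int) \<Rightarrow> bit" where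
  "chain_eval \<phi> c =
     of_int (poly_mapping.lookup (frag_extend (\<lambda>a. frag_cmul (of_bool (\<phi> a = 1)) (frag_of ())) c) ())"

lemma chain_eval_0 [simp]: "chain_eval \<phi> 0 = 0"
  by (simp add: chain_eval_def)

lemma chain_eval_of [simp]: "chain_eval \<phi> (frag_of a) = \<phi> a"
  by (cases "\<phi> a") (auto simp: chain_eval_def)

lemma chain_eval_add [simp]: "chain_eval \<phi> (b + c) = chain_eval \<phi> b + chain_eval \<phi> c"
  by (simp add: chain_eval_def frag_extend_add lookup_add)

lemma chain_eval_cmul: "chain_eval \<phi> (frag_cmul k c) = of_int k * chain_eval \<phi> c"
  by (simp add: chain_eval_def frag_extend_cmul)

lemma chain_eval_diff [simp]: "chain_eval \<phi> (b - c) = chain_eval \<phi> b + chain_eval \<phi> c"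
  by (simp add: chain_eval_def frag_extend_diff lookup_minus)

lemma chain_eval_sum: "chain_eval \<phi> (sum c I) = (\<Sum>i\<in>I. chain_eval \<phi> (c i))"
  by (induction I rule: infinite_finite_induct) auto

lemma chain_eval_sign [simp]: "chain_eval \<phi> (frag_cmul ((-1) ^ k) c) = chain_eval \<phi> c"
  by (simp add: chain_eval_cmul)

lemma chain_eval_eq_0: "(\<And>a. a \<in> Poly_Mapping.keys c \<Longrightarrow> \<phi> a = 0) \<Longrightarrow> chain_eval \<phi> c = 0"
  unfolding chain_eval_def by (subst frag_extend_eq_0) auto

section \<open>Cup products of coboundaries mod 2\<close>

text \<open>The coface map: vertex i of the k-th face of a simplex is its vertex
  \<open>skip k i\<close>.\<close>

definition skip :: "nat \<Rightarrow> nat \<Rightarrow> nat" where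
  "skip k i = (if i < k then i else Suc i)"

text \<open>With \<open>a i j\<close> read as the value of the i-th cochain at vertex j, this is the
  cocycle property of a product of p coboundaries on a simplex of dimension p + 1, the last face
  being moved to the right. In the induction step the new factor belongs to the edge from
  \<open>Suc p\<close> to \<open>Suc (Suc p)\<close> on the old faces and to the edge from p to
  \<open>Suc (Suc p)\<close> on the new one; mod 2 these add up to the edge from p to
  \<open>Suc p\<close>.\<close>

lemma sum_skip_prod:
  fixes a :: "nat \<Rightarrow> nat \<Rightarrow> bit"
  shows "(\<Sum>k\<le>p. \<Prod>i<p. a i (skip k i) + a i (skip k (Suc i))) = (\<Prod>i<p. a i i + a i (Suc i))"
proof (induction p)
  case (Suc p)
  have 1: "(\<Sum>k\<le>p. \<Prod>i<Suc p. a i (skip k i) + a i (skip k (Suc i)))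
      = (\<Sum>k\<le>p. \<Prod>i<p. a i (skip k i) + a i (skip k (Suc i))) * (a p (Suc p) + a p (Suc (Suc p)))"
    unfolding sum_distrib_right by (rule sum.cong) (auto simp: skip_def)
  have 2: "(\<Prod>i<Suc p. a i (skip (Suc p) i) + a i (skip (Suc p) (Suc i)))
      = (\<Prod>i<p. a i i + a i (Suc i)) * (a p p + a p (Suc (Suc p)))"
    by (auto simp: skip_def)
  have 3: "x * (b + c) + x * (d + c) = x * (d + b)" for x b c d :: bit
    by (cases x; cases b; cases c; cases d) auto
  show ?case
    unfolding sum.atMost_Suc 1 2 Suc.IH unfolding prod.lessThan_Suc by (rule 3)
qed simp

text \<open>The Leibniz rule for a product of coboundaries with one further 0-cochain. All faces but
  the last end at vertex \<open>Suc p\<close> and are summed by \<open>sum_skip_prod\<close>; the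
  last face ends at p and supplies the other half of the new coboundary.\<close>

lemma sum_skip_prod_last:
  fixes a :: "nat \<Rightarrow> nat \<Rightarrow> bit"
  shows "(\<Sum>k\<le>Suc p. (\<Prod>i<p. a i (skip k i) + a i (skip k (Suc i))) * a p (skip k p))
       = (\<Prod>i<Suc p. a i i + a i (Suc i))"
proof -
  have 1: "(\<Sum>k\<le>p. (\<Prod>i<p. a i (skip k i) + a i (skip k (Suc i))) * a p (skip k p))
      = (\<Prod>i<p. a i i + a i (Suc i)) * a p (Suc p)"
    unfolding sum_skip_prod[symmetric] sum_distrib_right by (rule sum.cong) (auto simp: skip_def)
  have 2: "(\<Prod>i<p. a i (skip (Suc p) i) + a i (skip (Suc p) (Suc i))) * a p (skip (Suc p) p)
      = (\<Prod>i<p. a i i + a i (Suc i)) * a p p"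
    by (auto simp: skip_def)
  show ?thesis
    unfolding sum.atMost_Suc 1 2 unfolding prod.lessThan_Suc by (simp only: distrib_left add.commute)
qed

definition vertex :: "((nat \<Rightarrow> real) \<Rightarrow> 'a) \<Rightarrow> nat \<Rightarrow> 'a" where
  "vertex \<sigma> i = \<sigma> (\<lambda>j. if j = i then 1 else 0)"

lemma vertex_singular_face:
  assumes "i \<le> p"
  shows "vertex (singular_face (Suc p) k \<sigma>) i = vertex \<sigma> (skip k i)"
proof -
  have "simplical_face k (\<lambda>j. if j = i then 1 else 0) = (\<lambda>j. if j = skip k i then 1 else (0::real))"
    by (auto simp: simplical_face_def skip_def fun_eq_iff)
  then show ?thesis
    using assms by (simp add: vertex_def singular_face_def)
qed

lemma vertex_simplex_map: "i \<le> p \<Longrightarrow> vertex (simplex_map p g \<sigma>) i = g (vertex \<sigma> i)"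
  by (simp add: vertex_def simplex_map_def)

lemma vertex_in_topspace: "singular_simplex p X \<sigma> \<Longrightarrow> i \<le> p \<Longrightarrow> vertex \<sigma> i \<in> topspace X"
  unfolding vertex_def singular_simplex_def continuous_map_def by (auto simp: Pi_iff)

text \<open>The cup product of the coboundaries of the 0-cochains \<open>s 0, \<dots>, s (p - 1)\<close>.\<close>

definition cup :: "(nat \<Rightarrow> 'a \<Rightarrow> bit) \<Rightarrow> nat \<Rightarrow> ((nat \<Rightarrow> real) \<Rightarrow> 'a) \<Rightarrow> bit" where
  "cup s p \<sigma> = (\<Prod>i<p. s i (vertex \<sigma> i) + s i (vertex \<sigma> (Suc i)))"

text \<open>Stokes' formula: mod 2 the signs of the boundary disappear, and on each simplex the
  Leibniz rule remains.\<close>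

lemma chain_eval_boundary_cup:
  "chain_eval (\<lambda>\<sigma>. cup s p \<sigma> * s p (vertex \<sigma> p)) (chain_boundary (Suc p) c) = chain_eval (cup s (Suc p)) c"
  using subset_UNIV
proof (induction c rule: frag_induction)
  case (one \<sigma>)
  have "cup s p (singular_face (Suc p) k \<sigma>) * s p (vertex (singular_face (Suc p) k \<sigma>) p)
    = (\<Prod>i<p. s i (vertex \<sigma> (skip k i)) + s i (vertex \<sigma> (skip k (Suc i)))) * s p (vertex \<sigma> (skip k p))"
    for k unfolding cup_def by (simp add: vertex_singular_face cong: prod.cong)
  then show ?case
    unfolding chain_boundary_of cup_def
    by (simp only: chain_eval_sum chain_eval_sign chain_eval_of nat.distinct if_False
        sum_skip_prod_last [where a = "\<lambda>i j. s i (vertex \<sigma> j)"])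
qed (auto simp: chain_boundary_diff)

text \<open>A coboundary does not change under \<nu>, since both ends of an edge flip. Only the last
  factor \<open>s p\<close> flips, and the two terms add up to the product without it.\<close>

lemma chain_eval_cup_antipodal:
  assumes c: "singular_chain p X c" and s: "\<And>i x. x \<in> topspace X \<Longrightarrow> s i (\<nu> x) = s i x + 1"
  shows "chain_eval (\<lambda>\<sigma>. cup s p \<sigma> * s p (vertex \<sigma> p)) c
       + chain_eval (\<lambda>\<sigma>. cup s p \<sigma> * s p (vertex \<sigma> p)) (chain_map p \<nu> c) = chain_eval (cup s p) c"
  using c unfolding singular_chain_def
proof (induction c rule: frag_induction)
  case (one \<sigma>)
  then have \<sigma>: "vertex \<sigma> i \<in> topspace X" if "i \<le> p" for i
    using that vertex_in_topspace by blast
  have 1: "x + 1 + (y + 1) = x + y" for x y :: bit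
    by (cases x; cases y) auto
  have "cup s p (simplex_map p \<nu> \<sigma>) = cup s p \<sigma>"
    unfolding cup_def
    by (rule prod.cong) (use \<sigma> s in \<open>auto simp: vertex_simplex_map 1\<close>)
  moreover have "s p (vertex (simplex_map p \<nu> \<sigma>) p) = s p (vertex \<sigma> p) + 1"
    using \<sigma> s by (simp add: vertex_simplex_map)
  moreover have "x * y + x * (y + 1) = x" for x y :: bit
    by (cases x; cases y) auto
  ultimately show ?case
    by simp
next
  case (diff a b)
  show ?case
    unfolding chain_map_diff chain_eval_diff diff(1)[symmetric] diff(2)[symmetric]
    by (simp only: ac_simps)
qed auto

text \<open>By induction on p: Stokes' formula moves the evaluation from \<open>h (Suc p)\<close> to
  its boundary, where the antipodal identity collapses the two terms to \<open>cup s p\<close> on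
  \<open>h p\<close>.\<close>

lemma chain_eval_cup_eq:
  assumes "\<And>i x. x \<in> topspace X \<Longrightarrow> s i (\<nu> x) = s i x + 1"
    and "\<And>i. i \<le> n \<Longrightarrow> singular_chain i X (h i)"
    and "\<And>i. i < n \<Longrightarrow> chain_boundary (Suc i) (h (Suc i)) = h i + frag_cmul ((-1) ^ Suc i) (chain_map i \<nu> (h i))"
    and "p \<le> n"
  shows "chain_eval (cup s p) (h p) = chain_eval (\<lambda>_. 1) (h 0)"
  using \<open>p \<le> n\<close>
proof (induction p)
  case 0
  then show ?case
    by (simp add: cup_def)
next
  case (Suc p)
  then show ?case
    using chain_eval_boundary_cup[of s p "h (Suc p)"] assms(3)[of p]
      chain_eval_cup_antipodal[of p X "h p" s \<nu>, OF assms(2) assms(1)]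
    by (simp del: power_Suc)
qed


section \<open>Antipodal chains on the sphere\<close>

text \<open>Reduced homology of the n-sphere is trivial in degrees other than n, and it agrees with
  unreduced homology in nonzero degrees; degree 0 is treated separately below.\<close>

lemma nsphere_cycle_is_boundary:
  assumes "0 < i" "i < n" and c: "singular_chain i (nsphere n) c" "chain_boundary i c = 0"
  obtains d where "singular_chain (Suc i) (nsphere n) d" "chain_boundary (Suc i) d = c"
proof -
  have "trivial_group (homology_group (int i) (nsphere n))"
    using trivial_reduced_homology_group_nsphere[of "int i" n] un_reduced_homology_group[of "int i" "nsphere n"] assms
    by simp
  then have "carrier (homology_group (int i) (nsphere n)) = {singular_relboundary_set i (nsphere n) {}}"
    by (simp add: trivial_group_def)
  moreover have "homologous_rel_set i (nsphere n) {} c \<in> carrier (homology_group (int i) (nsphere n))"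
    using c by (auto simp: carrier_relative_homology_group singular_cycle)
  ultimately have "singular_relboundary i (nsphere n) {} c"
    by (simp add: homologous_rel_set_eq_relboundary)
  then show thesis
    using that by (auto simp: singular_boundary)
qed

lemma continuous_map_nsphere_antipodal:
  "continuous_map (nsphere n) (nsphere n) (\<lambda>x i. - x i)"
proof -
  have "continuous_map (nsphere n) (powertop_real UNIV) (\<lambda>x i. - x i)"
    by (intro continuous_map_componentwise_UNIV[THEN iffD2] allI continuous_map_minus
        continuous_map_nsphere_projection)
  then show ?thesis
    unfolding nsphere continuous_map_in_subtopology by auto
qed

text \<open>For 0 < n the point x and its antipode both have last coordinate 0, so they lie in the
  closed upper hemisphere. That is contractible, hence path connected, and there two points are
  homologous.\<close>

lemma antipodal_boundary_0:
  assumes "0 < n" 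
    and x: "x = (\<lambda>i. if i = 0 then 1 else 0)"
  defines "h \<equiv> frag_of (restrict (\<lambda>_. x) (standard_simplex 0))"
  shows "\<exists>d. singular_chain (Suc 0) (nsphere n) d \<and>
             chain_boundary (Suc 0) d = h - chain_map 0 (\<lambda>x i. - x i) h"
proof -
  let ?H = "subtopology (nsphere n) {x. x n \<ge> 0}"
  have "path_connected_space ?H"
    by (simp add: contractible_imp_path_connected_space contractible_space_upper_hemisphere)
  have const: "singular_simplex 0 ?H (restrict (\<lambda>_. y) (standard_simplex 0))" if "y \<in> topspace ?H" for y
    using that by (simp add: singular_simplex_def)
  have xH: "x \<in> topspace ?H" "(\<lambda>i. - x i) \<in> topspace ?H"
    using in_topspace_nsphere[of n] continuous_map_funspace[OF continuous_map_nsphere_antipodal[of n]] assms(1)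
    by (auto simp: x)
  have "chain_map 0 (\<lambda>x i. - x i) h = frag_of (restrict (\<lambda>_ i. - x i) (standard_simplex 0))"
    by (auto simp: h_def simplex_map_def intro!: arg_cong[where f=frag_of])
  then have "singular_relboundary 0 ?H {} (h - chain_map 0 (\<lambda>x i. - x i) h)"
    using iso_integer_zeroth_homology_group_aux[OF \<open>path_connected_space ?H\<close> const[OF xH(1)] const[OF xH(2)]]
    by (simp add: homologous_rel_def h_def)
  then have "singular_relboundary 0 (nsphere n) {} (h - chain_map 0 (\<lambda>x i. - x i) h)"
    using singular_boundary_mono[of "{x. x n \<ge> 0}" UNIV 0 "nsphere n"] by simp
  then show ?thesis
    by (auto simp: singular_boundary)
qed

lemma antipodal_chains_exist:
  fixes n :: nat
  defines "\<nu> \<equiv> (\<lambda>x i. - x i) :: (nat \<Rightarrow> real) \<Rightarrow> nat \<Rightarrow> real"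
  obtains h where "\<And>i. i \<le> n \<Longrightarrow> singular_chain i (nsphere n) (h i)"
    and "\<And>i. i < n \<Longrightarrow> chain_boundary (Suc i) (h (Suc i)) = h i + frag_cmul ((-1) ^ Suc i) (chain_map i \<nu> (h i))"
    and "chain_eval (\<lambda>_. 1) (h 0) = 1"
proof -
  define P where "P i c d \<longleftrightarrow> singular_chain (Suc i) (nsphere n) d \<and>
      chain_boundary (Suc i) d = c + frag_cmul ((-1) ^ Suc i) (chain_map i \<nu> c)" for i c d
  \<comment> \<open>\<open>SOME\<close> picks each next chain before one is known to exist; the
    induction in \<open>*\<close> shows that the choice succeeds as long as i < n.\<close>
  define h where "h = rec_nat (frag_of (restrict (\<lambda>_ i. if i = 0 then 1 else 0) (standard_simplex 0))) (\<lambda>i c. SOME d. P i c d)"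
  have h0: "h 0 = frag_of (restrict (\<lambda>_ i. if i = 0 then 1 else 0) (standard_simplex 0))"
    and hSuc: "h (Suc i) = (SOME d. P i (h i) d)" for i
    by (simp_all add: h_def)
  have \<nu>: "continuous_map (nsphere n) (nsphere n) \<nu>"
    unfolding \<nu>_def by (rule continuous_map_nsphere_antipodal)
  have "\<nu> \<circ> \<nu> = id"
    by (auto simp: \<nu>_def fun_eq_iff)
  then have \<nu>\<nu>: "chain_map p \<nu> (chain_map p \<nu> c) = c" if "singular_chain p (nsphere n) c" for p c
    using that by (metis chain_map_compose chain_map_ident comp_apply)
  have *: "singular_chain i (nsphere n) (h i) \<and> P i (h i) (h (Suc i))" if "i < n" for i
    using that
  proof (induction i)
    case 0
    then have "\<exists>d. P 0 (h 0) d"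
      using antipodal_boundary_0[of n] by (simp add: h0 P_def \<nu>_def)
    then have "P 0 (h 0) (h (Suc 0))"
      unfolding hSuc by (rule someI_ex)
    then show ?case
      by (simp add: h0 singular_chain_of singular_simplex_def in_topspace_nsphere)
  next
    case (Suc i)
    define e :: int where "e = (-1) ^ Suc i"
    have e: "e * e = 1" "(-1) ^ Suc (Suc i) = - e"
      by (simp_all add: e_def flip: power_add mult_2)
    have hi: "singular_chain i (nsphere n) (h i)"
      and c: "singular_chain (Suc i) (nsphere n) (h (Suc i))"
      and b: "chain_boundary (Suc i) (h (Suc i)) = h i + frag_cmul e (chain_map i \<nu> (h i))"
      using Suc by (auto simp: P_def e_def)
    \<comment> \<open>The chain to be bounded next is a cycle: \<nu> is an involution and e * e = 1,
      so applying -e times \<nu> to the previous relation reproduces it with the opposite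
      sign.\<close>
    have "chain_boundary (Suc i) (h (Suc i) + frag_cmul (- e) (chain_map (Suc i) \<nu> (h (Suc i)))) = 0"
      by (simp add: chain_boundary_diff chain_boundary_cmul chain_boundary_chain_map[OF c] b
          chain_map_add \<nu>\<nu>[OF hi] frag_cmul_distrib2 e flip: minus_frag_cmul)
    moreover have "singular_chain (Suc i) (nsphere n) (h (Suc i) + frag_cmul (- e) (chain_map (Suc i) \<nu> (h (Suc i))))"
      by (intro singular_chain_add singular_chain_cmul singular_chain_chain_map[OF c \<nu>] c)
    ultimately have "\<exists>d. P (Suc i) (h (Suc i)) d"
      using nsphere_cycle_is_boundary[of "Suc i" n] Suc.prems unfolding P_def e by (metis zero_less_Suc)
    then have "P (Suc i) (h (Suc i)) (h (Suc (Suc i)))"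
      unfolding hSuc[of "Suc i"] by (rule someI_ex)
    with c show ?case
      by simp
  qed
  have "singular_chain i (nsphere n) (h i)" if "i \<le> n" for i
    using * that by (cases i) (auto simp: P_def h0 singular_chain_of singular_simplex_def in_topspace_nsphere Suc_le_eq)
  moreover have "chain_eval (\<lambda>_. 1) (h 0) = 1"
    by (simp add: h0)
  ultimately show thesis
    using * that unfolding P_def by blast
qed

section \<open>Subdivision and the contradiction\<close>

lemma singular_chain_subdivision_power:
  "singular_chain p X c \<Longrightarrow> singular_chain p X ((singular_subdivision p ^^ r) c)"
  by (induction r) (auto intro: singular_chain_singular_subdivision)

text \<open>Subdivision is a natural chain map: it commutes with the boundary and with the map
  induced by \<nu>.\<close>

lemma subdivision_power_antipodal_relation:
  assumes c: "singular_chain p X c" and d: "singular_chain (Suc p) X d"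
    and b: "chain_boundary (Suc p) d = c + frag_cmul k (chain_map p \<nu> c)"
    and \<nu>: "continuous_map X X \<nu>"
  shows "chain_boundary (Suc p) ((singular_subdivision (Suc p) ^^ r) d)
       = (singular_subdivision p ^^ r) c + frag_cmul k (chain_map p \<nu> ((singular_subdivision p ^^ r) c))"
proof (induction r)
  case (Suc r)
  have "singular_subdivision p (frag_cmul k a) = frag_cmul k (singular_subdivision p a)" for a :: "'a chain"
    by (simp add: singular_subdivision_def frag_extend_cmul)
  then show ?case
    using Suc singular_chain_subdivision_power[OF c, of r] singular_chain_subdivision_power[OF d, of r]
    by (simp add: chain_boundary_singular_subdivision singular_subdivision_add naturality_singular_subdivision)
qed (simp add: b)

theorem Borsuk_Ulam:
  assumes f: "continuous_map (nsphere n) (subtopology (Euclidean_space m) (- {\<lambda>_. 0})) f"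
    and odd: "\<And>x. x \<in> topspace (nsphere n) \<Longrightarrow> f (\<lambda>i. - x i) = (\<lambda>i. - f x i)"
  shows "n < m"
proof (rule ccontr)
  assume "\<not> n < m"
  then have "m \<le> n" by simp
  let ?X = "nsphere n" and ?\<nu> = "(\<lambda>x i. - x i) :: (nat \<Rightarrow> real) \<Rightarrow> nat \<Rightarrow> real"
  obtain h where h: "\<And>i. i \<le> n \<Longrightarrow> singular_chain i ?X (h i)"
    and bd: "\<And>i. i < n \<Longrightarrow> chain_boundary (Suc i) (h (Suc i)) = h i + frag_cmul ((-1) ^ Suc i) (chain_map i ?\<nu> (h i))"
    and h0: "chain_eval (\<lambda>_. 1) (h 0) = 1"
    using antipodal_chains_exist by blast
  define U where "U i = {x \<in> topspace ?X. f x i > 0}" for i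
  define V where "V i = {x \<in> topspace ?X. f x i < 0}" for i
  have f_in: "f x \<noteq> (\<lambda>_. 0)" "\<forall>i\<ge>m. f x i = 0" if "x \<in> topspace ?X" for x
    using continuous_map_funspace[OF f] that by (auto simp: topspace_Euclidean_space Pi_iff)
  have f_cont: "continuous_map ?X euclideanreal (\<lambda>x. f x i)" for i
    using f unfolding Euclidean_space_def continuous_map_in_subtopology continuous_map_componentwise_UNIV
    by auto
  have op: "openin ?X (U i)" "openin ?X (V i)" for i
    using openin_continuous_map_preimage[OF f_cont, of "{0<..}" i] openin_continuous_map_preimage[OF f_cont, of "{..<0}" i]
    by (auto simp: U_def V_def)
  have cover: "topspace ?X \<subseteq> \<Union>(U ` {..<m} \<union> V ` {..<m})"
  proof
    fix x assume x: "x \<in> topspace ?X"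
    then obtain i where "f x i \<noteq> 0"
      using f_in by blast
    moreover have "i < m"
      using f_in x calculation not_le by blast
    ultimately show "x \<in> \<Union>(U ` {..<m} \<union> V ` {..<m})"
      using x by (auto simp: U_def V_def neq_iff)
  qed
  have op': "openin ?X W" if "W \<in> U ` {..<m} \<union> V ` {..<m}" for W
    using that op by blast
  obtain r where r: "\<And>k \<sigma>. \<lbrakk>r \<le> k; \<sigma> \<in> Poly_Mapping.keys ((singular_subdivision m ^^ k) (h m))\<rbrakk>
      \<Longrightarrow> \<exists>W \<in> U ` {..<m} \<union> V ` {..<m}. \<sigma> \<in> standard_simplex m \<rightarrow> W"
  proof (rule sufficient_iterated_singular_subdivision_exists[OF op' cover h[OF \<open>m \<le> n\<close>]])
    fix r assume "\<And>k \<sigma>. \<lbrakk>r \<le> k; \<sigma> \<in> Poly_Mapping.keys ((singular_subdivision m ^^ k) (h m))\<rbrakk>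
      \<Longrightarrow> \<exists>W \<in> U ` {..<m} \<union> V ` {..<m}. \<sigma> \<in> standard_simplex m \<rightarrow> W"
    then show thesis
      by (rule that)
  qed
  \<comment> \<open>Where \<open>f x i\<close> vanishes, the value is taken from the first nonzero
    coordinate of x, so that \<open>s i\<close> flips under the antipodal map at every point of the
    sphere.\<close>
  define s where "s i x = (of_bool (if f x i = 0 then x (LEAST j. x j \<noteq> 0) > 0 else f x i > 0) :: bit)" for i x
  have s: "s i (?\<nu> x) = s i x + 1" if x: "x \<in> topspace ?X" for i x
  proof -
    have "x \<noteq> (\<lambda>_. 0)"
      using x by (auto simp: nsphere)
    then have "x (LEAST j. x j \<noteq> 0) \<noteq> 0"
      by (metis (mono_tags, lifting) LeastI ext)
    then show ?thesis
      using odd[OF x] by (auto simp: s_def)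
  qed
  \<comment> \<open>The number r is chosen to make the subdivision of \<open>h m\<close> fine, but
    every \<open>h i\<close> is subdivided r times, because the boundary relations link consecutive
    degrees.\<close>
  let ?g = "\<lambda>i. (singular_subdivision i ^^ r) (h i)"
  have "chain_eval (cup s m) (?g m) = chain_eval (\<lambda>_. 1) (?g 0)"
  proof (rule chain_eval_cup_eq[where s = s and h = ?g and \<nu> = ?\<nu> and X = ?X, OF s _ _ \<open>m \<le> n\<close>])
    show "singular_chain i ?X (?g i)" if "i \<le> n" for i
      by (rule singular_chain_subdivision_power[OF h[OF that]])
    show "chain_boundary (Suc i) (?g (Suc i)) = ?g i + frag_cmul ((-1) ^ Suc i) (chain_map i ?\<nu> (?g i))"
      if "i < n" for i
      by (rule subdivision_power_antipodal_relation[OF h h bd continuous_map_nsphere_antipodal])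
        (use that in auto)
  qed
  also have "?g 0 = h 0"
    using h[of 0] by (induction r) (auto simp: singular_subdivision_zero)
  finally have "chain_eval (cup s m) (?g m) = 1"
    using h0 by simp
  moreover have "chain_eval (cup s m) (?g m) = 0"
  proof (rule chain_eval_eq_0)
    fix \<sigma> assume "\<sigma> \<in> Poly_Mapping.keys (?g m)"
    then obtain i where i: "i < m" and "\<sigma> \<in> standard_simplex m \<rightarrow> U i \<or> \<sigma> \<in> standard_simplex m \<rightarrow> V i"
      using r[OF order_refl] by blast
    then have "(\<forall>j\<le>m. vertex \<sigma> j \<in> U i) \<or> (\<forall>j\<le>m. vertex \<sigma> j \<in> V i)"
      by (auto simp: vertex_def Pi_iff)
    \<comment> \<open>As i < m, the edge from i to \<open>Suc i\<close> belongs to the m-simplex.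
      The cochain \<open>s i\<close> is constant on \<open>U i\<close> and on \<open>V i\<close>, so
      the i-th factor of the cup product is 0.\<close>
    then have "vertex \<sigma> i \<in> U i \<and> vertex \<sigma> (Suc i) \<in> U i \<or> vertex \<sigma> i \<in> V i \<and> vertex \<sigma> (Suc i) \<in> V i"
      using i by (meson Suc_leI less_imp_le)
    then have "s i (vertex \<sigma> i) = s i (vertex \<sigma> (Suc i))"
      by (auto simp: U_def V_def s_def)
    then show "cup s m \<sigma> = 0"
      unfolding cup_def using i by (intro prod_zero) (auto intro!: bexI[of _ i])
  qed
  ultimately show False
    by simp
qed

subsection \<open>The minimax values and the Cheeger constants\<close>

lemma edge_cases:
  assumes "simple_graph E" "e \<in> E"
  obtains i j where "e = {i, j}" "i \<noteq> j"
  using assms by (auto simp: simple_graph_def card_2_iff)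

lemma deg_eq_card_incident:
  assumes "simple_graph E"
  shows "deg E i = card {e \<in> E. i \<in> e}"
  unfolding deg_def
proof (rule bij_betw_same_card)
  show "bij_betw (\<lambda>j. {i, j}) {j. {i, j} \<in> E} {e \<in> E. i \<in> e}"
    unfolding bij_betw_def
  proof
    show "inj_on (\<lambda>j. {i, j}) {j. {i, j} \<in> E}"
      by (auto simp: inj_on_def doubleton_eq_iff)
    show "(\<lambda>j. {i, j}) ` {j. {i, j} \<in> E} = {e \<in> E. i \<in> e}"
    proof (intro equalityI subsetI)
      fix e assume e: "e \<in> {e \<in> E. i \<in> e}"
      then obtain a b where "e = {a, b}"
        using assms by (blast elim: edge_cases)
      with e have "e = {i, a} \<or> e = {i, b}"
        by auto
      with e show "e \<in> (\<lambda>j. {i, j}) ` {j. {i, j} \<in> E}"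
        by blast
    qed auto
  qed
qed

lemma deg_pos:
  fixes E :: "'n::finite set set"
  assumes "connected_graph E" and "CARD('n) \<ge> 2"
  shows "deg E i > 0"
proof -
  have "UNIV \<noteq> {i}"
    using assms(2) by (auto dest: arg_cong[where f = card])
  then obtain j where "j \<noteq> i"
    by blast
  moreover have "(i, j) \<in> {(i, j). {i, j} \<in> E}\<^sup>*"
    using assms(1) by (simp add: connected_graph_def)
  ultimately obtain k where "{i, k} \<in> E"
    by (auto elim: converse_rtranclE)
  then show ?thesis
    by (auto simp: deg_def card_gt_0_iff)
qed

lemma vol_pos:
  fixes E :: "'n::finite set set"
  assumes "connected_graph E" "CARD('n) \<ge> 2" "A \<noteq> {}"
  shows "vol E A > 0"
  unfolding vol_def by (rule sum_pos) (use assms(3) deg_pos[OF assms(1,2)] in auto)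

lemma tv_nonneg: "simple_graph E \<Longrightarrow> tv E x \<ge> 0"
  unfolding tv_def by (rule sum_nonneg) (metis abs_ge_zero edge_cases edge_diff_pair)

text \<open>The triangle inequality on each edge, followed by double counting of incidences. It
  bounds \<open>tv\<close> on \<open>wsphere\<close>, so that the real suprema in
  \<open>minmax_c\<close> are taken over bounded sets.\<close>

lemma tv_le_weighted_norm:
  assumes "simple_graph E"
  shows "tv E x \<le> (\<Sum>i\<in>UNIV. real (deg E i) * \<bar>x $ i\<bar>)"
proof -
  have "tv E x \<le> (\<Sum>e\<in>E. \<Sum>i\<in>e. \<bar>x $ i\<bar>)"
    unfolding tv_def
  proof (rule sum_mono)
    fix e assume "e \<in> E"
    then obtain i j where "e = {i, j}" "i \<noteq> j"
      using assms by (blast elim: edge_cases)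
    then show "edge_diff x e \<le> (\<Sum>i\<in>e. \<bar>x $ i\<bar>)"
      by (simp add: edge_diff_pair)
  qed
  also have "\<dots> = (\<Sum>e\<in>E. \<Sum>i\<in>UNIV. if i \<in> e then \<bar>x $ i\<bar> else 0)"
    by (simp add: sum.If_cases)
  also have "\<dots> = (\<Sum>i\<in>UNIV. \<Sum>e\<in>E. if i \<in> e then \<bar>x $ i\<bar> else 0)"
    by (rule sum.swap)
  also have "\<dots> = (\<Sum>i\<in>UNIV. real (deg E i) * \<bar>x $ i\<bar>)"
    by (simp add: sum.If_cases deg_eq_card_incident[OF assms] Int_def)
  finally show ?thesis .
qed

lemma tv_le_1: "simple_graph E \<Longrightarrow> x \<in> wsphere E \<Longrightarrow> tv E x \<le> 1"
  using tv_le_weighted_norm[of E x] by (simp add: wsphere_def)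

section \<open>Combinations of indicator vectors\<close>

definition indicator_comb :: "'k set \<Rightarrow> ('k \<Rightarrow> 'n set) \<Rightarrow> ('k \<Rightarrow> real) \<Rightarrow> real ^ 'n::finite" where
  "indicator_comb K S a = (\<chi> i. \<Sum>k\<in>K. a k * indicator (S k) i)"

text \<open>Along an edge the indicator of \<open>S k\<close> changes, by 1 in absolute value,
  exactly when the edge lies in the boundary of \<open>S k\<close>; the triangle inequality over k
  gives the estimate.\<close>

lemma tv_indicator_comb_le:
  assumes "simple_graph E" "finite K"
  shows "tv E (indicator_comb K S a) \<le> (\<Sum>k\<in>K. \<bar>a k\<bar> * real (card (edge_boundary E (S k))))"
proof -
  let ?x = "indicator_comb K S a"
  have "edge_diff ?x e \<le> (\<Sum>k\<in>K. \<bar>a k\<bar> * indicator (edge_boundary E (S k)) e)" if e: "e \<in> E" for e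
  proof -
    obtain i j where ij: "e = {i, j}"
      using assms e by (blast elim: edge_cases)
    have "edge_diff ?x e = \<bar>\<Sum>k\<in>K. a k * (indicator (S k) i - indicator (S k) j)\<bar>"
      by (simp add: ij edge_diff_pair indicator_comb_def right_diff_distrib sum_subtractf)
    also have "\<dots> \<le> (\<Sum>k\<in>K. \<bar>a k * (indicator (S k) i - indicator (S k) j)\<bar>)"
      by (rule sum_abs)
    also have "\<dots> \<le> (\<Sum>k\<in>K. \<bar>a k\<bar> * indicator (edge_boundary E (S k)) e)"
      by (rule sum_mono) (use e in \<open>auto simp: ij edge_boundary_def indicator_def abs_mult doubleton_eq_iff\<close>)
    finally show ?thesis .
  qed
  then have "tv E ?x \<le> (\<Sum>e\<in>E. \<Sum>k\<in>K. \<bar>a k\<bar> * indicator (edge_boundary E (S k)) e)"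
    unfolding tv_def by (rule sum_mono)
  also have "\<dots> = (\<Sum>k\<in>K. \<Sum>e\<in>E. \<bar>a k\<bar> * indicator (edge_boundary E (S k)) e)"
    by (rule sum.swap)
  also have "\<dots> = (\<Sum>k\<in>K. \<bar>a k\<bar> * real (card (edge_boundary E (S k))))"
  proof (rule sum.cong)
    fix k
    have "E \<inter> edge_boundary E (S k) = edge_boundary E (S k)"
      by (auto simp: edge_boundary_def)
    then show "(\<Sum>e\<in>E. \<bar>a k\<bar> * indicator (edge_boundary E (S k)) e)
        = \<bar>a k\<bar> * real (card (edge_boundary E (S k)))"
      unfolding sum_distrib_left[symmetric] by (simp add: indicator_def sum.If_cases)
  qed simp
  finally show ?thesis .
qed

text \<open>By disjointness at most one summand is nonzero at each vertex, so the absolute value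
  passes inside the sum and equality holds.\<close>

lemma weighted_norm_indicator_comb:
  assumes "finite K" "disjoint_family_on S K"
  shows "(\<Sum>i\<in>UNIV. real (deg E i) * \<bar>indicator_comb K S a $ i\<bar>) = (\<Sum>k\<in>K. \<bar>a k\<bar> * real (vol E (S k)))"
proof -
  have "\<bar>indicator_comb K S a $ i\<bar> = (\<Sum>k\<in>K. \<bar>a k\<bar> * indicator (S k) i)" for i
  proof (cases "\<exists>k\<in>K. i \<in> S k")
    case True
    then obtain l where l: "l \<in> K" "i \<in> S l"
      by blast
    have "i \<notin> S k" if "k \<in> K - {l}" for k
      using that l assms(2) by (auto simp: disjoint_family_on_def)
    then have "(\<Sum>k\<in>K. c k * indicator (S k) i) = c l" for c :: "_ \<Rightarrow> real"
      using sum.remove[OF assms(1) l(1), of "\<lambda>k. c k * indicator (S k) i"] l by simp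
    then show ?thesis
      by (simp add: indicator_comb_def)
  next
    case False
    then have "(\<Sum>k\<in>K. c k * indicator (S k) i) = 0" for c :: "_ \<Rightarrow> real"
      by (intro sum.neutral) auto
    then show ?thesis
      by (simp add: indicator_comb_def)
  qed
  then have "(\<Sum>i\<in>UNIV. real (deg E i) * \<bar>indicator_comb K S a $ i\<bar>)
      = (\<Sum>i\<in>UNIV. \<Sum>k\<in>K. \<bar>a k\<bar> * (indicator (S k) i * real (deg E i)))"
    by (simp add: sum_distrib_left mult_ac)
  also have "\<dots> = (\<Sum>k\<in>K. \<Sum>i\<in>UNIV. \<bar>a k\<bar> * (indicator (S k) i * real (deg E i)))"
    by (rule sum.swap)
  also have "\<dots> = (\<Sum>k\<in>K. \<bar>a k\<bar> * real (vol E (S k)))"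
    by (simp add: sum_distrib_left[symmetric] vol_def indicator_def if_distrib[where f="\<lambda>x. x * _"] sum.If_cases cong: if_cong)
  finally show ?thesis .
qed

lemma subspace_indicator_comb: "subspace (range (indicator_comb K S))"
proof (rule subspaceI)
  show "0 \<in> range (indicator_comb K S)"
    by (rule range_eqI[of _ _ "\<lambda>_. 0"]) (simp add: indicator_comb_def vec_eq_iff)
next
  fix x y assume "x \<in> range (indicator_comb K S)" "y \<in> range (indicator_comb K S)"
  then obtain a b where "x = indicator_comb K S a" "y = indicator_comb K S b"
    by blast
  then have "x + y = indicator_comb K S (\<lambda>k. a k + b k)"
    by (simp add: indicator_comb_def vec_eq_iff distrib_right sum.distrib)
  then show "x + y \<in> range (indicator_comb K S)"
    by blast
next
  fix c x assume "x \<in> range (indicator_comb K S)"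
  then obtain a where "x = indicator_comb K S a"
    by blast
  then have "c *\<^sub>R x = indicator_comb K S (\<lambda>k. c * a k)"
    by (simp add: indicator_comb_def vec_eq_iff sum_distrib_left mult_ac)
  then show "c *\<^sub>R x \<in> range (indicator_comb K S)"
    by blast
qed

section \<open>Genus estimates and the upper bound on the minimax values\<close>

lemma closed_wsphere: "closed (wsphere E)"
  unfolding wsphere_def by (intro closed_Collect_eq continuous_intros)

text \<open>For k \<ge> 1 this excludes the empty set from the competitors in
  \<open>minmax_c\<close>, so no supremum over the empty set arises.\<close>

lemma genus_empty: "genus ({} :: (real ^ 'n::finite) set) = 0"
proof -
  have "genus ({} :: (real ^ 'n) set) \<le> enat 0"
    unfolding genus_def by (rule Inf_lower) auto
  then show ?thesis
    by (simp flip: zero_enat_def)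
qed

lemma nsphere_euclidean: "nsphere n = top_of_set (topspace (nsphere n))"
  by (simp add: nsphere euclidean_product_topology)

text \<open>Composing g with an odd map from A to R^m - 0 gives an odd map on the n-sphere, and
  Borsuk-Ulam yields n < m. The bound is \<open>Suc n\<close> because the n-sphere has n + 1
  coordinates.\<close>

lemma genus_geI:
  fixes g :: "(nat \<Rightarrow> real) \<Rightarrow> real ^ 'n::finite"
  assumes cont: "continuous_on (topspace (nsphere n)) g"
    and into: "g ` topspace (nsphere n) \<subseteq> A"
    and odd: "\<And>y. y \<in> topspace (nsphere n) \<Longrightarrow> g (\<lambda>i. - y i) = - g y"
  shows "genus A \<ge> enat (Suc n)"
  unfolding genus_def
proof (rule Inf_greatest, clarify)
  fix m f
  assume f: "continuous_map (top_of_set A) (subtopology (Euclidean_space m) (- {\<lambda>_. 0})) f"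
    and f_odd: "\<forall>x\<in>A. - x \<in> A \<longrightarrow> f (- x) = (\<lambda>i. - f x i)"
  have "continuous_map (nsphere n) (top_of_set A) g"
    using cont into by (subst nsphere_euclidean) (auto simp: continuous_map_in_subtopology)
  then have "continuous_map (nsphere n) (subtopology (Euclidean_space m) (- {\<lambda>_. 0})) (f \<circ> g)"
    using f by (rule continuous_map_compose)
  moreover have "(f \<circ> g) (\<lambda>i. - y i) = (\<lambda>i. - (f \<circ> g) y i)" if y: "y \<in> topspace (nsphere n)" for y
  proof -
    have "(\<lambda>i. - y i) \<in> topspace (nsphere n)"
      using y by (auto simp: nsphere)
    then show ?thesis
      using odd[OF y] into y f_odd by (metis comp_apply imageI subsetD)
  qed
  ultimately have "n < m"
    by (rule Borsuk_Ulam)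
  then show "enat (Suc n) \<le> enat m"
    by simp
qed

lemma genus_indicator_comb:
  fixes E :: "'n::finite set set" and S :: "nat \<Rightarrow> 'n set"
  assumes "connected_graph E" "CARD('n) \<ge> 2"
    and ne: "\<And>i. i \<le> n \<Longrightarrow> S i \<noteq> {}" and disj: "disjoint_family_on S {..n}"
  shows "genus (range (indicator_comb {..n} S) \<inter> wsphere E) \<ge> enat (Suc n)"
proof -
  \<comment> \<open>\<open>N y\<close> is the weighted norm of the combination with coefficients y;
    dividing by it places the combination on \<open>wsphere\<close>. It is positive on the sphere
    since every volume is.\<close>
  define N where "N y = (\<Sum>k\<le>n. \<bar>y k\<bar> * real (vol E (S k)))" for y :: "nat \<Rightarrow> real"
  define g where "g y = indicator_comb {..n} S (\<lambda>k. y k / N y)" for y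
  have N: "N y > 0" if "y \<in> topspace (nsphere n)" for y
  proof -
    have "(\<Sum>k\<le>n. (y k)\<^sup>2) \<noteq> 0"
      using that by (simp add: nsphere)
    then obtain k where k: "k \<le> n" "y k \<noteq> 0"
      by (auto elim!: sum.not_neutral_contains_not_neutral)
    show ?thesis
      unfolding N_def
      by (rule sum_pos2[of _ k]) (use k vol_pos[OF assms(1,2) ne] in auto)
  qed
  show ?thesis
  proof (rule genus_geI)
    have coord: "continuous_on T (\<lambda>y. y k)" for T :: "(nat \<Rightarrow> real) set" and k
      by (rule continuous_on_subset[OF continuous_on_product_coordinates subset_UNIV])
    show "continuous_on (topspace (nsphere n)) g"
      unfolding g_def indicator_comb_def N_def
      by (intro continuous_on_vec_lambda continuous_intros coord) (use N in \<open>force simp: N_def\<close>)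
    show "g ` topspace (nsphere n) \<subseteq> range (indicator_comb {..n} S) \<inter> wsphere E"
    proof clarify
      fix y assume y: "y \<in> topspace (nsphere n)"
      have "(\<Sum>k\<le>n. \<bar>y k / N y\<bar> * real (vol E (S k))) = (\<Sum>k\<le>n. \<bar>y k\<bar> * real (vol E (S k))) / N y"
        using N[OF y] by (simp add: sum_divide_distrib)
      also have "\<dots> = 1"
        using N[OF y] by (simp flip: N_def)
      finally have "(\<Sum>k\<le>n. \<bar>y k / N y\<bar> * real (vol E (S k))) = 1" .
      then have "g y \<in> wsphere E"
        by (simp add: wsphere_def g_def weighted_norm_indicator_comb[OF _ disj])
      then show "g y \<in> range (indicator_comb {..n} S) \<inter> wsphere E"
        by (simp add: g_def)
    qed
    show "g (\<lambda>i. - y i) = - g y" for y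
      by (simp add: g_def N_def indicator_comb_def vec_eq_iff sum_negf)
  qed
qed

text \<open>Any admissible A bounds the infimum, once the inner suprema are known to be bounded
  below: each is at least 0, because admissible sets are nonempty and \<open>tv\<close> takes values
  between 0 and 1 on them.\<close>

lemma minmax_c_le:
  assumes E: "simple_graph E" and k: "k \<ge> 1"
    and A: "closed A" "uminus ` A = A" "A \<subseteq> wsphere E" "genus A \<ge> enat k"
    and tv: "\<And>x. x \<in> A \<Longrightarrow> tv E x \<le> c"
  shows "minmax_c E k \<le> c"
proof -
  have ne: "B \<noteq> {}" if "genus B \<ge> enat k" for B :: "(real ^ 'a) set"
    using that k by (auto simp: genus_empty zero_enat_def)
  have "minmax_c E k \<le> (SUP x\<in>A. tv E x)"
    unfolding minmax_c_def
  proof (rule cINF_lower)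
    show "bdd_below ((\<lambda>A. SUP x\<in>A. tv E x) ` {A. closed A \<and> uminus ` A = A \<and> A \<subseteq> wsphere E \<and> genus A \<ge> enat k})"
    proof (rule bdd_belowI2)
      fix B assume B: "B \<in> {A. closed A \<and> uminus ` A = A \<and> A \<subseteq> wsphere E \<and> genus A \<ge> enat k}"
      then obtain x where "x \<in> B"
        using ne by blast
      moreover have "bdd_above (tv E ` B)"
        using B tv_le_1[OF E] by (auto intro!: bdd_aboveI2[of _ _ 1])
      ultimately show "0 \<le> (SUP x\<in>B. tv E x)"
        using tv_nonneg[OF E] by (meson cSUP_upper order_trans)
    qed
  qed (use A in simp)
  also have "\<dots> \<le> c"
    using ne[OF A(4)] tv by (rule cSUP_least)
  finally show ?thesis .
qed

text \<open>The trace of the span of the indicators on \<open>wsphere\<close> is the competitor. On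
  it \<open>tv\<close> is at most the sum of the boundary sizes weighted by the absolute
  coefficients, hence at most h times the weighted volumes, whose sum is 1.\<close>

lemma minmax_c_le_max_ratio:
  fixes E :: "'n::finite set set" and S :: "nat \<Rightarrow> 'n set"
  assumes E: "simple_graph E" "connected_graph E" "CARD('n) \<ge> 2"
    and ne: "\<And>i. i \<le> n \<Longrightarrow> S i \<noteq> {}" and disj: "disjoint_family_on S {..n}"
    and ratio: "\<And>i. i \<le> n \<Longrightarrow> real (card (edge_boundary E (S i))) / real (vol E (S i)) \<le> h"
  shows "minmax_c E (Suc n) \<le> h"
proof (rule minmax_c_le[OF E(1), where A = "range (indicator_comb {..n} S) \<inter> wsphere E"])
  let ?V = "range (indicator_comb {..n} S)"
  have V: "subspace ?V"
    by (rule subspace_indicator_comb)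
  then show "closed (?V \<inter> wsphere E)"
    by (intro closed_Int closed_subspace closed_wsphere)
  have "- x \<in> ?V \<inter> wsphere E" if "x \<in> ?V \<inter> wsphere E" for x
    using that subspace_neg[OF V] by (auto simp: wsphere_def)
  then show "uminus ` (?V \<inter> wsphere E) = ?V \<inter> wsphere E"
    by (metis (no_types, lifting) add.inverse_inverse image_eqI image_subsetI subsetI subset_antisym)
  show "genus (?V \<inter> wsphere E) \<ge> enat (Suc n)"
    using E(2,3) ne disj by (rule genus_indicator_comb)
  show "tv E x \<le> h" if "x \<in> ?V \<inter> wsphere E" for x
  proof -
    from that obtain a where x: "x = indicator_comb {..n} S a"
      by blast
    have norm: "(\<Sum>k\<le>n. \<bar>a k\<bar> * real (vol E (S k))) = 1"
      using that weighted_norm_indicator_comb[OF _ disj, of E a] by (auto simp: x wsphere_def)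
    have "tv E x \<le> (\<Sum>k\<le>n. \<bar>a k\<bar> * real (card (edge_boundary E (S k))))"
      unfolding x using E(1) by (rule tv_indicator_comb_le) simp
    also have "\<dots> \<le> (\<Sum>k\<le>n. \<bar>a k\<bar> * (h * real (vol E (S k))))"
      using ratio vol_pos[OF E(2,3) ne]
      by (intro sum_mono mult_left_mono) (auto simp: divide_le_eq)
    also have "\<dots> = h * (\<Sum>k\<le>n. \<bar>a k\<bar> * real (vol E (S k)))"
      by (simp add: sum_distrib_left mult_ac)
    finally show ?thesis
      by (simp add: norm)
  qed
qed auto

text \<open>There are infinitely many functions S on the naturals, but each value is the maximum of
  a subset of the finite range of the ratio.\<close>

lemma finite_cheeger_values:
  fixes E :: "'n::finite set set"
  shows "finite {Max ((\<lambda>i. real (card (edge_boundary E (S i))) / real (vol E (S i))) ` {1..k}) | S.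
        (\<forall>i\<in>{1..k}. S i \<noteq> {}) \<and> disjoint_family_on S {1..k}}" (is "finite ?M")
proof (rule finite_subset)
  let ?\<rho> = "\<lambda>A. real (card (edge_boundary E A)) / real (vol E A)"
  show "?M \<subseteq> Max ` Pow (range ?\<rho>)"
    by auto
  show "finite (Max ` Pow (range ?\<rho>))"
    by (intro finite_imageI) simp
qed

lemma minmax_c_le_cheeger_h:
  fixes E :: "'n::finite set set"
  assumes E: "simple_graph E" "connected_graph E" "CARD('n) \<ge> 2" and k: "k \<in> {1..CARD('n)}"
  shows "minmax_c E k \<le> cheeger_h E k"
proof -
  let ?\<rho> = "\<lambda>A. real (card (edge_boundary E A)) / real (vol E A)"
  let ?M = "{Max ((\<lambda>i. ?\<rho> (S i)) ` {1..k}) | S. (\<forall>i\<in>{1..k}. S i \<noteq> {}) \<and> disjoint_family_on S {1..k}}"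
  \<comment> \<open>Since k is at most the number of vertices, k distinct singletons form an
    admissible tuple, and the minimum is attained.\<close>
  obtain f :: "nat \<Rightarrow> 'n" where "inj_on f {1..k}"
    using k card_le_inj[of "{1..k}" "UNIV :: 'n set"] by auto
  then have "disjoint_family_on (\<lambda>i. {f i}) {1..k}"
    unfolding disjoint_family_on_def by (blast dest: inj_onD)
  then have "Max ((\<lambda>i. ?\<rho> {f i}) ` {1..k}) \<in> ?M"
    by (intro CollectI exI[of _ "\<lambda>i. {f i}"]) simp
  then have "?M \<noteq> {}"
    by (metis (no_types) empty_iff)
  then have "cheeger_h E k \<in> ?M"
    unfolding cheeger_h_def by (rule Min_in[OF finite_cheeger_values])
  then obtain S where S: "\<And>i. i \<in> {1..k} \<Longrightarrow> S i \<noteq> {}" "disjoint_family_on S {1..k}"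
    and h: "cheeger_h E k = Max ((\<lambda>i. ?\<rho> (S i)) ` {1..k})"
    by (elim CollectE exE conjE) (rule that, auto)
  \<comment> \<open>The minimising tuple is reindexed from 1, ..., k to 0, ..., k - 1, the
    coordinates of the (k - 1)-sphere.\<close>
  have "minmax_c E (Suc (k - 1)) \<le> cheeger_h E k"
  proof (rule minmax_c_le_max_ratio[OF E, where S = "\<lambda>i. S (Suc i)"])
    show "S (Suc i) \<noteq> {}" if "i \<le> k - 1" for i
      using that k S by auto
    show "disjoint_family_on (\<lambda>i. S (Suc i)) {..k - 1}"
      using S(2) k by (auto simp: disjoint_family_on_def)
    show "?\<rho> (S (Suc i)) \<le> cheeger_h E k" if "i \<le> k - 1" for i
      unfolding h using that k by (intro Max_ge) auto
  qed
  then show ?thesis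
    using k by simp
qed

section \<open>Nodal domains and the lower bound\<close>

text \<open>A discrete divergence theorem: inside D the antisymmetric terms cancel in pairs, and
  each edge leaving D contributes 1.\<close>

lemma antisym_flow_eq_card_boundary:
  fixes z :: "'n::finite \<Rightarrow> 'n \<Rightarrow> real"
  assumes anti: "\<And>i j. {i, j} \<in> E \<Longrightarrow> z j i = - z i j"
    and out: "\<And>i j. {i, j} \<in> E \<Longrightarrow> i \<in> D \<Longrightarrow> j \<notin> D \<Longrightarrow> z i j = 1"
  shows "(\<Sum>i\<in>D. \<Sum>j | {i, j} \<in> E. z i j) = real (card (edge_boundary E D))"
proof -
  let ?in = "\<Sum>i\<in>D. \<Sum>j\<in>D. if {i, j} \<in> E then z i j else 0"
  \<comment> \<open>The boundary edges oriented outwards; since exactly one end lies in D, the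
    orientation is unique and forgetting it is a bijection onto the boundary.\<close>
  let ?O = "SIGMA i:D. {j. {i, j} \<in> E \<and> j \<notin> D}"
  have "?in = (\<Sum>j\<in>D. \<Sum>i\<in>D. if {i, j} \<in> E then z i j else 0)"
    by (rule sum.swap)
  also have "\<dots> = (\<Sum>j\<in>D. \<Sum>i\<in>D. - (if {j, i} \<in> E then z j i else 0))"
  proof (intro sum.cong refl)
    show "(if {i, j} \<in> E then z i j else 0) = - (if {j, i} \<in> E then z j i else 0)" for i j
      using anti[of i j] by (simp add: insert_commute)
  qed
  also have "\<dots> = - ?in"
    by (simp add: sum_negf)
  finally have in_0: "?in = 0"
    by simp
  have "(\<Sum>j | {i, j} \<in> E. z i j)
      = (\<Sum>j\<in>D. if {i, j} \<in> E then z i j else 0) + (\<Sum>j | {i, j} \<in> E \<and> j \<notin> D. z i j)" for i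
  proof -
    have "(\<Sum>j | {i, j} \<in> E. z i j) = (\<Sum>j\<in>D \<inter> {j. {i, j} \<in> E}. z i j) + (\<Sum>j | {i, j} \<in> E \<and> j \<notin> D. z i j)"
      by (subst sum.union_disjoint[symmetric]) (auto intro!: sum.cong)
    then show ?thesis
      by (simp add: sum.inter_restrict)
  qed
  then have "(\<Sum>i\<in>D. \<Sum>j | {i, j} \<in> E. z i j) = (\<Sum>i\<in>D. \<Sum>j | {i, j} \<in> E \<and> j \<notin> D. z i j)"
    by (simp add: sum.distrib in_0)
  also have "\<dots> = (\<Sum>i\<in>D. \<Sum>j | {i, j} \<in> E \<and> j \<notin> D. 1)"
    by (intro sum.cong) (use out in auto)
  also have "\<dots> = real (card ?O)"
    by simp
  also have "card ?O = card (edge_boundary E D)"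
  proof (rule bij_betw_same_card)
    show "bij_betw (\<lambda>(i, j). {i, j}) ?O (edge_boundary E D)"
      unfolding bij_betw_def inj_on_def
      by (auto simp: edge_boundary_def doubleton_eq_iff)
  qed
  finally show ?thesis .
qed

lemma induced_comps_equiv:
  "equiv U ({(i, j). i \<in> U \<and> j \<in> U \<and> {i, j} \<in> E}\<^sup>* \<inter> U \<times> U)"
proof -
  have "sym ({(i, j). i \<in> U \<and> j \<in> U \<and> {i, j} \<in> E}\<^sup>*)"
    by (rule sym_rtrancl) (auto simp: sym_def insert_commute)
  then show ?thesis
    unfolding equiv_def refl_on_def sym_def trans_def by (auto intro: rtrancl_trans)
qed

lemma induced_comps_nonempty: "D \<in> induced_comps E U \<Longrightarrow> D \<noteq> {}"
  unfolding induced_comps_def using in_quotient_imp_non_empty induced_comps_equiv by blast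

lemma induced_comps_subset: "D \<in> induced_comps E U \<Longrightarrow> D \<subseteq> U"
  unfolding induced_comps_def using in_quotient_imp_subset induced_comps_equiv by blast

lemma induced_comps_disjoint:
  "D \<in> induced_comps E U \<Longrightarrow> D' \<in> induced_comps E U \<Longrightarrow> D \<noteq> D' \<Longrightarrow> D \<inter> D' = {}"
  unfolding induced_comps_def using quotient_disj induced_comps_equiv by blast

text \<open>Used to see that a neighbour outside a nodal domain does not share its sign, which fixes
  z on the boundary edges.\<close>

lemma induced_comps_edge:
  assumes D: "D \<in> induced_comps E U" and "i \<in> D" "j \<in> U" "{i, j} \<in> E"
  shows "j \<in> D"
  using D[unfolded induced_comps_def] \<open>i \<in> D\<close>
  by (rule in_quotient_imp_closed[OF induced_comps_equiv])
    (use assms induced_comps_subset[OF D] in auto)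

lemma nodal_domain_nonempty: "D \<in> nodal_domains E x \<Longrightarrow> D \<noteq> {}"
  by (auto simp: nodal_domains_def dest: induced_comps_nonempty)

lemma nodal_domains_disjoint:
  assumes "D \<in> nodal_domains E x" "D' \<in> nodal_domains E x" "D \<noteq> D'"
  shows "D \<inter> D' = {}"
proof -
  have "D \<inter> D' = {}"
    if "D \<in> induced_comps E {i. x $ i > 0}" "D' \<in> induced_comps E {i. x $ i < 0}" for D D'
    using that[THEN induced_comps_subset] by force
  then show ?thesis
    using assms induced_comps_disjoint unfolding nodal_domains_def by (metis Int_commute UnE)
qed

text \<open>On D the vector is nonzero, so \<open>Sgn\<close> is a single value both at the vertices
  of D and on the edges leaving D, even those towards zeros of x. Both sides of the summed
  eigenvalue equation are thus determined.\<close>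

lemma nodal_domain_boundary:
  assumes x: "one_lap_eigenvector E \<mu> x" and D: "D \<in> nodal_domains E x"
  shows "real (card (edge_boundary E D)) = \<mu> * real (vol E D)"
proof -
  obtain z where z: "\<And>i j. {i, j} \<in> E \<Longrightarrow> z i j \<in> Sgn (x $ i - x $ j)"
    and anti: "\<And>i j. {i, j} \<in> E \<Longrightarrow> z j i = - z i j"
    and eig: "\<And>i. (\<Sum>j | {i, j} \<in> E. z i j) \<in> (\<lambda>s. \<mu> * real (deg E i) * s) ` Sgn (x $ i)"
    using x unfolding one_lap_eigenvector_def by blast
  consider (pos) "D \<in> induced_comps E {i. x $ i > 0}" | (neg) "D \<in> induced_comps E {i. x $ i < 0}"
    using D by (auto simp: nodal_domains_def)
  then show ?thesis
  proof cases
    case pos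
    have D_pos: "x $ i > 0" if "i \<in> D" for i
      using induced_comps_subset[OF pos] that by auto
    have "z i j = 1" if "{i, j} \<in> E" "i \<in> D" "j \<notin> D" for i j
    proof -
      have "x $ j \<le> 0"
        using induced_comps_edge[OF pos that(2) _ that(1)] that(3) by force
      then show ?thesis
        using z[OF that(1)] D_pos[OF that(2)] by (simp add: Sgn_def)
    qed
    then have "real (card (edge_boundary E D)) = (\<Sum>i\<in>D. \<Sum>j | {i, j} \<in> E. z i j)"
      using anti by (intro antisym_flow_eq_card_boundary[symmetric])
    also have "\<dots> = (\<Sum>i\<in>D. \<mu> * real (deg E i))"
    proof (rule sum.cong)
      fix i assume "i \<in> D"
      then show "(\<Sum>j | {i, j} \<in> E. z i j) = \<mu> * real (deg E i)"
        using eig[of i] D_pos[of i] by (simp add: Sgn_def)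
    qed simp
    finally show ?thesis
      by (simp add: vol_def sum_distrib_left)
  next
    case neg
    have D_neg: "x $ i < 0" if "i \<in> D" for i
      using induced_comps_subset[OF neg] that by auto
    \<comment> \<open>On a negative domain the outward flow is -1, so the divergence identity is
      applied to -z.\<close>
    have "- z i j = 1" if "{i, j} \<in> E" "i \<in> D" "j \<notin> D" for i j
    proof -
      have "x $ j \<ge> 0"
        using induced_comps_edge[OF neg that(2) _ that(1)] that(3) by force
      then show ?thesis
        using z[OF that(1)] D_neg[OF that(2)] by (simp add: Sgn_def)
    qed
    then have "real (card (edge_boundary E D)) = (\<Sum>i\<in>D. \<Sum>j | {i, j} \<in> E. - z i j)"
      using anti by (intro antisym_flow_eq_card_boundary[symmetric]) auto
    also have "\<dots> = (\<Sum>i\<in>D. \<mu> * real (deg E i))"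
    proof (rule sum.cong)
      fix i assume "i \<in> D"
      then show "(\<Sum>j | {i, j} \<in> E. - z i j) = \<mu> * real (deg E i)"
        using eig[of i] D_neg[of i] by (simp add: Sgn_def sum_negf)
    qed simp
    finally show ?thesis
      by (simp add: vol_def sum_distrib_left)
  qed
qed

text \<open>Any m nodal domains form a competitor for the m-way Cheeger constant, and each of them
  has ratio exactly \<mu>.\<close>

lemma cheeger_h_le_eigenvalue:
  fixes E :: "'n::finite set set"
  assumes E: "connected_graph E" "CARD('n) \<ge> 2"
    and x: "one_lap_eigenvector E \<mu> x" and m: "1 \<le> m" "m \<le> card (nodal_domains E x)"
  shows "cheeger_h E m \<le> \<mu>"
proof -
  let ?\<rho> = "\<lambda>A. real (card (edge_boundary E A)) / real (vol E A)"
  obtain S where S: "inj_on S {1..m}" "S ` {1..m} \<subseteq> nodal_domains E x"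
    using m card_le_inj[of "{1..m}" "nodal_domains E x"] by auto
  have nonempty: "\<forall>i\<in>{1..m}. S i \<noteq> {}"
    using S(2) nodal_domain_nonempty by blast
  have "disjoint_family_on S {1..m}"
    unfolding disjoint_family_on_def
  proof (intro ballI impI)
    fix i j assume ij: "i \<in> {1..m}" "j \<in> {1..m}" "i \<noteq> j"
    then have "S i \<noteq> S j"
      using S(1) by (blast dest: inj_onD)
    then show "S i \<inter> S j = {}"
      using ij image_subset_iff[THEN iffD1, OF S(2)] by (intro nodal_domains_disjoint[of _ E x]) simp_all
  qed
  then have "cheeger_h E m \<le> Max ((\<lambda>i. ?\<rho> (S i)) ` {1..m})"
    unfolding cheeger_h_def using nonempty
    by (intro Min_le[OF finite_cheeger_values] CollectI exI[of _ S]) simp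
  also have "\<dots> \<le> \<mu>"
  proof (rule Max.boundedI)
    fix r assume "r \<in> (\<lambda>i. ?\<rho> (S i)) ` {1..m}"
    then obtain i where i: "i \<in> {1..m}" "r = ?\<rho> (S i)"
      by blast
    then have "vol E (S i) > 0"
      using vol_pos[OF E] nonempty by blast
    then show "r \<le> \<mu>"
      using nodal_domain_boundary[OF x] S(2) i by (simp add: image_subset_iff)
  qed (use m in auto)
  finally show ?thesis .
qed

theorem theorem8:
  fixes E :: "'n::finite set set"
  assumes "simple_graph E" and "connected_graph E" and "CARD('n) \<ge> 2"
  shows "(\<forall>k\<in>{1..CARD('n)}. minmax_c E k \<le> cheeger_h E k) \<and>
         (\<forall>k\<in>{1..CARD('n)}. \<forall>\<phi> m.
            one_lap_eigenvector E (minmax_c E k) \<phi> \<longrightarrow> m \<ge> 1 \<longrightarrow>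
            card (nodal_domains E \<phi>) \<ge> m \<longrightarrow> cheeger_h E m \<le> minmax_c E k)"
  using minmax_c_le_cheeger_h[OF assms] cheeger_h_le_eigenvalue[OF assms(2,3)] by blast

end
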